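(* Let $n$ be a positive integer with $6\mid n$ and $n/6$ odd. Let $k_1$ be an even divisor of $n$ with $\gcd(3,k_1)=1$, and let $S=\mathbb{F}_{2^3}\cup\mathbb{F}_{2^{k_1}}\subseteq\mathbb{F}_{2^n}$. Then the function $f(x)=x^{-1}+\delta_S(x)$ is a differentially 4-uniform permutation over $\mathbb{F}_{2^n}$.
   Context: The convention $0^{-1}=0$ is used, so $x^{-1}=x^{2^n-2}$ on $\mathbb{F}_{2^n}$. For $S\subseteq\mathbb{F}_{2^n}$, $\delta_S:\mathbb{F}_{2^n}\to\mathbb{F}_2\subseteq\mathbb{F}_{2^n}$ is the characteristic function: $\delta_S(x)=1$ if $x\in S$ and $\delta_S(x)=0$ otherwise. For $f:\mathbb{F}_{2^n}\to\mathbb{F}_{2^n}$, the differential uniformity is $\Delta_f=\max\{N(a,b): a,b\in\mathbb{F}_{2^n}, a\neq 0\}$, where $N(a,b)$ is the number of $x\in\mathbb{F}_{2^n}$ with $f(x+a)+f(x)=b$. $f$ is differentially 4-uniform if $\Delta_f=4$. *)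

theory Defs
  imports "HOL-Algebra.Algebraic_Closure_Type" "HOL-Library.Indicator_Function"
    "HOL-Library.Cardinality"
begin

definition differential_count :: "('a::{finite,field} \<Rightarrow> 'a) \<Rightarrow> 'a \<Rightarrow> 'a \<Rightarrow> nat" where
  "differential_count f a b = card {x. f (x + a) + f x = b}"

text \<open>The difference of \<open>f\<close> is written with a plus sign, so the following notion is the usual
  one only in characteristic 2.\<close>

definition differential_uniformity :: "('a::{finite,field} \<Rightarrow> 'a) \<Rightarrow> nat" where
  "differential_uniformity f = Max {differential_count f a b | a b. a \<noteq> 0}"

definition differentially_4_uniform :: "('a::{finite,field} \<Rightarrow> 'a) \<Rightarrow> bool" where
  "differentially_4_uniform f \<longleftrightarrow> differential_uniformity f = 4"

end

theory Submission
  imports Defs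
begin

text \<open>
  The set \<open>S\<close> is closed under inversion and under \<open>x \<mapsto> x + 1\<close>, so \<open>f\<close> is inversion followed by
  an involution. For fixed \<open>a \<noteq> 0\<close> let \<open>P c\<close> be the set of solutions of \<open>1/x + 1/(x + a) = c\<close>. It has
  the form \<open>{x, x + a}\<close> or is empty unless \<open>c = 1/a\<close>, and \<open>P (1/a) = {0, a, a w, a w^2}\<close> with
  \<open>w\<close> a primitive cube root of unity. The solutions of \<open>f (x + a) + f x = b\<close> consist of part of
  \<open>P b\<close> and part of \<open>P (b + 1)\<close>, so more than four of them require \<open>b = 1/a\<close> or \<open>b + 1 = 1/a\<close>,
  together with a solution of \<open>1/x + 1/(x + a) = 1/a + 1\<close>. If \<open>b = 1/a\<close>, then \<open>a\<close> and \<open>x\<close> lie in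
  different fields of the union and \<open>a\<close> is quadratic over the field of \<open>x\<close>, which is excluded by
  degrees. If \<open>b + 1 = 1/a\<close>, then \<open>a = t w^2\<close> with \<open>t\<close> in the field of order 8 but not in the prime
  field, and \<open>1/(a + 1)\<close> has trace 1, so that \<open>y^2 + y = 1/(a + 1)\<close> has no solution.
\<close>

section \<open>Arithmetic in characteristic 2\<close>

lemma two_eq_0: "CHAR('a::field) = 2 \<Longrightarrow> (2::'a) = 0"
  by (metis of_nat_CHAR of_nat_numeral)

lemma char2_simps:
  assumes "CHAR('a::field) = 2"
  shows "(x::'a) + x = 0" "x + (x + y) = y" "- x = x" "x - y = x + y" "x + y = 0 \<longleftrightarrow> x = y"
proof -
  show self: "z + z = 0" for z :: 'a using two_eq_0[OF assms] by (metis mult_2 mult_zero_left)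
  show "x + (x + y) = y" using self[of x] by (metis add.assoc add_0)
  show neg: "- z = z" for z :: 'a using self by (metis add_eq_0_iff)
  show "x - y = x + y" by (metis diff_conv_add_uminus neg)
  show "x + y = 0 \<longleftrightarrow> x = y" by (metis add_eq_0_iff neg)
qed

lemma frobenius_add:
  "CHAR('a::field) = 2 \<Longrightarrow> (x + y :: 'a) ^ (2 ^ k) = x ^ (2 ^ k) + y ^ (2 ^ k)"
  by (rule freshmans_dream') auto

lemma frobenius_add_numeral:
  assumes "CHAR('a::field) = 2"
  shows "(x + y :: 'a) ^ 2 = x ^ 2 + y ^ 2" "(x + y) ^ 4 = x ^ 4 + y ^ 4" "(x + y) ^ 8 = x ^ 8 + y ^ 8"
  using frobenius_add[OF assms, of x y 1] frobenius_add[OF assms, of x y 2]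
    frobenius_add[OF assms, of x y 3] by simp_all

section \<open>Fixed points of powers of the Frobenius map\<close>

lemma frobenius_fixed_mult:
  fixes a :: "'a::field"
  assumes "a ^ (2 ^ j) = a"
  shows "a ^ (2 ^ (j * i)) = a"
proof (induction i)
  case (Suc i)
  have "a ^ (2 ^ (j * Suc i)) = (a ^ (2 ^ j)) ^ (2 ^ (j * i))"
    by (simp add: power_add flip: power_mult)
  then show ?case using Suc assms by simp
qed simp

lemma frobenius_fixed_mod:
  fixes a :: "'a::field"
  assumes "a ^ (2 ^ j) = a" "a ^ (2 ^ k) = a"
  shows "a ^ (2 ^ (k mod j)) = a"
proof -
  have "a = a ^ (2 ^ (j * (k div j) + k mod j))" using assms(2) by simp
  also have "\<dots> = (a ^ (2 ^ (j * (k div j)))) ^ (2 ^ (k mod j))"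
    by (simp only: power_add power_mult)
  finally show ?thesis using frobenius_fixed_mult[OF assms(1)] by simp
qed

text \<open>The fields of order 8 and \<open>2 ^ k\<close> meet in the prime field because 3 and
  \<open>k\<close> are coprime. Reducing \<open>k\<close> modulo 3 leaves \<open>a ^ 2 = a\<close>
  or \<open>a ^ 4 = a\<close>, and the latter gives \<open>a ^ 8 = a ^ 2\<close>.\<close>

lemma fixed_pow_8_imp_prime_field:
  fixes a :: "'a::field"
  assumes "a ^ 8 = a" "a ^ (2 ^ k) = a" "\<not> 3 dvd k"
  shows "a = 0 \<or> a = 1"
proof -
  have *: "a ^ (2 ^ (k mod 3)) = a" using frobenius_fixed_mod[of a 3 k] assms by simp
  have "k mod 3 = 1 \<or> k mod 3 = 2" using assms(3) by presburger
  then have "a ^ 2 = a"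
  proof
    assume "k mod 3 = 2"
    then have "a ^ 4 = a" using * by simp
    moreover have "a ^ 8 = (a ^ 4) ^ 2" by (simp flip: power_mult)
    ultimately show ?thesis using assms(1) by simp
  qed (use * in simp)
  then show ?thesis by (simp add: power2_eq_square)
qed

text \<open>The fields of order 64 and \<open>2 ^ k\<close> meet in the field of order 4, since
  \<open>gcd 6 k = 2\<close>.\<close>

lemma fixed_pow_64_imp_fixed_pow_4:
  fixes a :: "'a::field"
  assumes "a ^ 64 = a" "a ^ (2 ^ k) = a" "even k" "\<not> 3 dvd k"
  shows "a ^ 4 = a"
proof -
  have *: "a ^ (2 ^ (k mod 6)) = a" using frobenius_fixed_mod[of a 6 k] assms by simp
  have "k mod 6 = 2 \<or> k mod 6 = 4" using assms(3,4) by presburger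
  then show ?thesis
  proof
    assume "k mod 6 = 4"
    then have "a ^ 16 = a" using * by simp
    moreover have "a ^ 64 = (a ^ 16) ^ 4" by (simp flip: power_mult)
    ultimately show ?thesis using assms(1) by simp
  qed (use * in simp)
qed

text \<open>The \<open>k\<close>-fold Frobenius map fixes the coefficients, so it sends roots to
  roots. If it moves \<open>u\<close>, subtracting the two equations determines the sum of the two
  roots, and applying the map to that relation shows that its square fixes \<open>u\<close>.\<close>

lemma quadratic_frobenius:
  fixes u :: "'a::field"
  assumes char2: "CHAR('a) = 2"
    and eq: "A * u ^ 2 + B * u + C = 0" and "A \<noteq> 0"
    and coeffs: "A ^ (2 ^ k) = A" "B ^ (2 ^ k) = B" "C ^ (2 ^ k) = C"
  shows "u ^ (2 ^ (2 * k)) = u"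
proof -
  note c2 = two_eq_0[OF char2] char2_simps[OF char2]
  define F :: "'a \<Rightarrow> 'a" where "F z = z ^ (2 ^ k)" for z
  have F_add: "F (x + y) = F x + F y" and F_mult: "F (x * y) = F x * F y" for x y
    by (auto simp: F_def frobenius_add[OF char2] power_mult_distrib)
  have F_fix: "F A = A" "F B = B" "F C = C" "F 0 = 0" using coeffs by (auto simp: F_def)
  have "F (A * u ^ 2 + B * u + C) = 0" using eq F_fix by simp
  then have eq': "A * F u ^ 2 + B * F u + C = 0"
    by (simp add: F_add F_mult F_fix power2_eq_square)
  have FF: "F (F u) = u"
  proof (cases "F u = u")
    case False
    have "(F u - u) * (A * (F u + u) + B) = 0" using eq eq' by Groebner_Basis.algebra
    then have sum: "A * (F u + u) + B = 0" using False by simp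
    then have "F (A * (F u + u) + B) = 0" using F_fix by simp
    then have "A * (F (F u) + F u) + B = 0" by (simp add: F_add F_mult F_fix)
    then have "A * (F (F u) - u) = 0" using sum by Groebner_Basis.algebra
    then show ?thesis using \<open>A \<noteq> 0\<close> by simp
  qed simp
  have "u ^ (2 ^ (2 * k)) = F (F u)"
    by (simp add: F_def mult_2 power_add flip: power_mult)
  then show ?thesis using FF by simp
qed

section \<open>Exclusion of the two critical configurations\<close>

lemma inverse_eq_polynomial:
  fixes a x :: "'a::field"
  assumes char2: "CHAR('a) = 2" and "a \<noteq> 0"
    and eq: "inverse x + inverse (x + a) = inverse a + 1"
  shows "a ^ 2 = (a + 1) * (x * (x + a))"
proof -
  note c2 = two_eq_0[OF char2] char2_simps[OF char2]
  \<comment> \<open>If \<open>x\<close> or \<open>x + a\<close> were 0, the convention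
    \<open>inverse 0 = 0\<close> would make the left side of \<open>eq\<close> equal to
    \<open>inverse a\<close>.\<close>
  have "x \<noteq> 0" using eq by auto
  have "x + a \<noteq> 0"
    using eq c2 by auto
  have "(x + a + x) * a = (a + 1) * (x * (x + a))"
    using eq \<open>x \<noteq> 0\<close> \<open>x + a \<noteq> 0\<close> \<open>a \<noteq> 0\<close> by (simp add: field_simps)
  moreover have "x + a + x = a" using c2 by (simp add: add_ac)
  ultimately show ?thesis by (simp add: power2_eq_square)
qed

text \<open>Settles \<open>b = inverse a\<close>. If \<open>x\<close> has degree dividing 3, then
  \<open>a\<close> lies in the fields of order 64 and \<open>2 ^ k\<close>, hence in that of order
  4. Otherwise \<open>a\<close> lies in the fields of order 8 and \<open>2 ^ (2 * k)\<close>, hence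
  in the prime field.\<close>

lemma quadratic_case_excluded:
  fixes a x :: "'a::field"
  assumes char2: "CHAR('a) = 2" and "even k" "\<not> 3 dvd k" and "a \<noteq> 0"
    and S: "S = {x. x ^ 8 = x} \<union> {x. x ^ (2 ^ k) = x}"
    and "a \<in> S" "x \<in> S" "x + a \<notin> S"
    and eq: "inverse x + inverse (x + a) = inverse a + 1"
  shows False
proof -
  note c2 = two_eq_0[OF char2] char2_simps[OF char2]
  \<comment> \<open>Regrouping by powers of \<open>a\<close> puts all coefficients into the field of
    \<open>x\<close>.\<close>
  have quad: "(x + 1) * a ^ 2 + (x ^ 2 + x) * a + x ^ 2 = 0"
  proof -
    have "(x + 1) * a ^ 2 + (x ^ 2 + x) * a + x ^ 2 = a ^ 2 + (a + 1) * (x * (x + a))"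
      by (simp add: algebra_simps power2_eq_square)
    then show ?thesis
      using inverse_eq_polynomial[OF char2 \<open>a \<noteq> 0\<close> eq] c2 by simp
  qed
  have coeffs: "(x + 1) ^ (2 ^ j) = x + 1" "(x ^ 2 + x) ^ (2 ^ j) = x ^ 2 + x"
    "(x ^ 2) ^ (2 ^ j) = x ^ 2" if "x ^ (2 ^ j) = x" for j
    using that by (auto simp: frobenius_add[OF char2] power_mult_distrib power2_eq_square)
  have "x \<noteq> 0" using \<open>x + a \<notin> S\<close> \<open>a \<in> S\<close> by auto
  \<comment> \<open>Both fields contain 1, so \<open>x = 1\<close> would put \<open>x + a\<close>
    into the field of \<open>a\<close>.\<close>
  have "x \<noteq> 1"
    using \<open>x + a \<notin> S\<close> \<open>a \<in> S\<close> unfolding S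
    by (auto simp: frobenius_add[OF char2] frobenius_add_numeral[OF char2])
  then have "x + 1 \<noteq> 0" using c2 by simp
  have not_both: "\<not> (x ^ 8 = x \<and> a ^ 8 = a)" "\<not> (x ^ (2 ^ k) = x \<and> a ^ (2 ^ k) = a)"
    using \<open>x + a \<notin> S\<close> unfolding S
    by (auto simp: frobenius_add[OF char2] frobenius_add_numeral[OF char2])
  have frob: "a ^ (2 ^ (2 * j)) = a" if "x ^ (2 ^ j) = x" for j
    using quadratic_frobenius[OF char2 quad \<open>x + 1 \<noteq> 0\<close> coeffs[OF that]] .
  show False
  proof (cases "x ^ 8 = x")
    case True
    then have ak: "a ^ (2 ^ k) = a" and "a ^ 64 = a"
      using \<open>a \<in> S\<close> not_both frob[of 3] unfolding S by auto
    then have "a ^ 4 = a" using fixed_pow_64_imp_fixed_pow_4 assms by blast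
    then have "a * (a - 1) * (a ^ 2 + a + 1) = 0" by (simp add: algebra_simps eval_nat_numeral)
    moreover have "a \<noteq> 1" using True not_both(1) by auto
    ultimately have "a ^ 2 + a + 1 = 0" using \<open>a \<noteq> 0\<close> by simp
    then have a2: "a ^ 2 = a + 1" using c2 by (metis add.assoc)
    \<comment> \<open>Reducing \<open>a ^ 2\<close> leaves a linear equation for \<open>a\<close>
      over the field of order 8.\<close>
    have "a * (x + 1) ^ 2 + (x ^ 2 + x + 1) = 0"
      using quad unfolding a2 by (simp add: c2 algebra_simps power2_eq_square)
    then have "a * (x + 1) ^ 2 = x ^ 2 + x + 1" using c2 by blast
    then have "a = (x ^ 2 + x + 1) / (x + 1) ^ 2" using \<open>x + 1 \<noteq> 0\<close> by (simp add: field_simps)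
    then have "a ^ 8 = a"
      using coeffs[of 3] True
      by (simp add: power_divide frobenius_add_numeral[OF char2] flip: power_mult)
    then show False using True not_both by blast
  next
    case False
    then have xk: "x ^ (2 ^ k) = x" using \<open>x \<in> S\<close> unfolding S by auto
    then have a8: "a ^ 8 = a" using \<open>a \<in> S\<close> not_both unfolding S by auto
    have "a ^ (2 ^ (2 * k)) = a" using frob xk by blast
    moreover have "\<not> 3 dvd 2 * k" using \<open>\<not> 3 dvd k\<close> by presburger
    ultimately have "a = 0 \<or> a = 1" using fixed_pow_8_imp_prime_field a8 by blast
    then show False using not_both xk by auto
  qed
qed

text \<open>Settles \<open>b + 1 = inverse a\<close>, for either primitive cube root
  \<open>w\<close>. A solution of \<open>y ^ 2 + y = c\<close> with \<open>c\<close> in the field of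
  order 64 satisfies \<open>y ^ 64 = y + T\<close>, where \<open>T\<close> is the absolute trace of
  \<open>c\<close> from that field. Here \<open>T = 1\<close>, so an odd number \<open>m\<close> of
  such steps adds 1 to \<open>y\<close>, contradicting \<open>fixed\<close>.\<close>

lemma trace_case_excluded:
  fixes a w x :: "'a::field"
  assumes char2: "CHAR('a) = 2" and "even k" "\<not> 3 dvd k"
    and w: "w ^ 2 + w + 1 = 0"
    and S: "S = {x. x ^ 8 = x} \<union> {x. x ^ (2 ^ k) = x}"
    and "a \<notin> S" "a * w \<in> S"
    and fixed: "\<And>y::'a. y ^ (64 ^ m) = y" and "odd m"
    and eq: "inverse x + inverse (x + a) = inverse a + 1"
  shows False
proof -
  note c2 = two_eq_0[OF char2] char2_simps[OF char2]
  note add8 = frobenius_add_numeral[OF char2]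
  define t where "t = a * w"
  have w3: "w ^ 3 = 1" using w by Groebner_Basis.algebra
  have "w ^ 4 = w" using w3 by Groebner_Basis.algebra
  then have wk: "w ^ (2 ^ k) = w"
    using frobenius_fixed_mult[of w 2 "k div 2"] \<open>even k\<close> by simp
  have a: "a = t * w ^ 2" using w3 unfolding t_def by Groebner_Basis.algebra
  have "t ^ (2 ^ k) \<noteq> t"
  proof
    assume "t ^ (2 ^ k) = t"
    then have "a ^ (2 ^ k) = a"
      unfolding a using wk by (simp add: power_mult_distrib power2_eq_square)
    then show False using \<open>a \<notin> S\<close> S by auto
  qed
  then have t8: "t ^ 8 = t" and "t \<noteq> 0" "t \<noteq> 1"
    using \<open>a * w \<in> S\<close> S unfolding t_def by auto
  have "a \<noteq> 0" "a \<noteq> 1" using \<open>a \<notin> S\<close> S by auto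
  then have "a + 1 \<noteq> 0" using c2 by simp
  define c where "c = inverse (a + 1)"
  \<comment> \<open>Scaling by \<open>a\<close> turns the quadratic for \<open>x\<close> into
    \<open>y ^ 2 + y = c\<close>.\<close>
  define y where "y = x / a"
  have c: "c * (a + 1) = 1" using \<open>a + 1 \<noteq> 0\<close> by (simp add: c_def)
  have "x = y * a" using \<open>a \<noteq> 0\<close> by (simp add: y_def)
  then have "a ^ 2 * ((a + 1) * (y ^ 2 + y)) = a ^ 2 * 1"
    using inverse_eq_polynomial[OF char2 \<open>a \<noteq> 0\<close> eq] by Groebner_Basis.algebra
  then have "(a + 1) * (y ^ 2 + y) = 1" using \<open>a \<noteq> 0\<close> by (metis mult_left_cancel power_not_zero)
  then have "y ^ 2 + y = c" using c by (metis mult.assoc mult.commute mult_1)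
  then have y2: "y ^ 2 = y + c" using c2 by (metis add.commute)
  have y4: "y ^ 4 = y + c + c ^ 2"
  proof -
    have "y ^ 4 = (y ^ 2) ^ 2" by (simp flip: power_mult)
    also have "\<dots> = y + c + c ^ 2" unfolding y2 add8 by (simp add: y2)
    finally show ?thesis .
  qed
  have y8: "y ^ 8 = y + (c + c ^ 2 + c ^ 4)"
  proof -
    have "y ^ 8 = (y ^ 4) ^ 2" by (simp flip: power_mult)
    also have "\<dots> = y + (c + c ^ 2 + c ^ 4)"
      unfolding y4 add8 by (simp add: y2 add_ac flip: power_mult)
    finally show ?thesis .
  qed
  \<comment> \<open>The conjugate of \<open>c\<close> over the field of order 8: the eighth power
    fixes \<open>t\<close> and sends \<open>w ^ 2\<close> to \<open>w\<close>.\<close>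
  define d where "d = c ^ 8"
  have "w ^ 16 = w" using w3 by Groebner_Basis.algebra
  then have "(a + 1) ^ 8 = t * w + 1"
    unfolding add8 a using t8 by (simp add: power_mult_distrib flip: power_mult)
  then have d: "d * (t * w + 1) = 1"
    using c unfolding d_def by (metis power_mult_distrib power_one)
  define v where "v = c + d"
  have v: "v * (t ^ 2 + t + 1) = t"
  proof -
    have w2: "w ^ 2 = w + 1" using w c2 by (metis add.assoc)
    \<comment> \<open>This is the norm of \<open>a + 1\<close> to the field of order 8.\<close>
    have prod: "t ^ 2 + t + 1 = (a + 1) * (t * w + 1)"
      using w2 unfolding a power2_eq_square by (simp add: c2 algebra_simps)
    have "v * (t ^ 2 + t + 1) = c * (a + 1) * (t * w + 1) + d * (t * w + 1) * (a + 1)"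
      unfolding prod v_def by (simp add: algebra_simps)
    also have "\<dots> = t"
      unfolding c d unfolding a w2 by (simp add: c2 algebra_simps)
    finally show ?thesis .
  qed
  \<comment> \<open>Factorization of \<open>t ^ 8 - t\<close> over the prime field, with its two
    irreducible cubics.\<close>
  have "t * (t - 1) * ((t ^ 3 + t + 1) * (t ^ 3 + t ^ 2 + 1)) = 0"
    using t8 by (simp add: c2 algebra_simps eval_nat_numeral)
  then have "t ^ 3 + t + 1 = 0 \<or> t ^ 3 + t ^ 2 + 1 = 0" using \<open>t \<noteq> 0\<close> \<open>t \<noteq> 1\<close> by simp
  \<comment> \<open>\<open>v\<close> is the relative trace of \<open>c\<close> from the field of order 64 to that of order 8.\<close>
  then have trace: "v + v ^ 2 + v ^ 4 = 1"
  proof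
    assume "t ^ 3 + t + 1 = 0"
    then have "t * (t * t) = t + 1" using c2 by (simp add: eval_nat_numeral add.assoc)
    then have t3: "t * (t * t) = t + 1" "t * (t * (t * z)) = t * z + z" for z
      by (simp_all flip: mult.assoc) (simp add: algebra_simps)
    \<comment> \<open>\<open>t ^ 2\<close> is the inverse of \<open>t ^ 2 + t + 1\<close>; in the other case it is \<open>t ^ 3\<close>.\<close>
    have "v = v * (t ^ 2 + t + 1) * t ^ 2" by (simp add: c2 t3 algebra_simps eval_nat_numeral)
    also have "\<dots> = t + 1" unfolding v by (simp add: t3 eval_nat_numeral)
    finally show ?thesis by (simp add: c2 t3 algebra_simps eval_nat_numeral)
  next
    assume "t ^ 3 + t ^ 2 + 1 = 0"
    then have "t * (t * t) = t * t + 1" using c2 by (simp add: eval_nat_numeral add.assoc)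
    then have t3: "t * (t * t) = t * t + 1" "t * (t * (t * z)) = t * (t * z) + z" for z
      by (simp_all flip: mult.assoc) (simp add: algebra_simps)
    have "v = v * (t ^ 2 + t + 1) * t ^ 3" by (simp add: c2 t3 algebra_simps eval_nat_numeral)
    also have "\<dots> = t * t + t + 1" unfolding v by (simp add: c2 t3 algebra_simps eval_nat_numeral)
    finally show ?thesis by (simp add: c2 t3 algebra_simps eval_nat_numeral)
  qed
  have y64: "y ^ 64 = y + 1"
  proof -
    have "y ^ 64 = (y ^ 8) ^ 8" by (simp flip: power_mult)
    also have "\<dots> = y ^ 8 + (d + d ^ 2 + d ^ 4)"
      unfolding d_def by (subst y8) (simp add: add8 flip: power_mult)
    also have "\<dots> = y + (v + v ^ 2 + v ^ 4)"
      unfolding y8 v_def add8 by (simp add: add_ac)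
    finally show ?thesis using trace by simp
  qed
  have "y ^ (64 ^ i) = y + of_nat i" for i
  proof (induction i)
    case (Suc i)
    have "y ^ (64 ^ Suc i) = (y ^ 64) ^ (64 ^ i)" by (simp flip: power_mult)
    also have "\<dots> = (y + 1) ^ (2 ^ (6 * i))" unfolding y64 by (simp add: power_mult)
    also have "\<dots> = y ^ (64 ^ i) + 1" unfolding frobenius_add[OF char2] by (simp add: power_mult)
    finally show ?case using Suc by simp
  qed simp
  then have "of_nat m = (0::'a)" using fixed[of y] by (metis add_cancel_left_right)
  then show False using \<open>odd m\<close> char2 by (metis of_nat_eq_0_iff_char_dvd)
qed

section \<open>Finite fields: characteristic, subfields, cube roots of unity\<close>

lemma CHAR_eq_2:
  assumes "CARD('a::{finite,field}) = 2 ^ n"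
  shows "CHAR('a) = 2"
proof -
  \<comment> \<open>Translation by 1 permutes the field, so the cardinality vanishes in it.\<close>
  have "(\<Sum>x\<in>(UNIV::'a set). x + 1) = (\<Sum>x\<in>UNIV. x)"
    by (rule sum.reindex_bij_witness[of _ "\<lambda>x. x - 1" "\<lambda>x. x + 1"]) auto
  then have "of_nat (CARD('a)) = (0::'a)" by (simp add: sum.distrib)
  then have "CHAR('a) dvd 2 ^ n" using assms by (metis of_nat_eq_0_iff_char_dvd)
  moreover have "prime CHAR('a)"
    by (rule prime_CHAR_semidom) (simp add: finite_imp_CHAR_pos)
  ultimately show ?thesis
    by (metis prime_dvd_power primes_dvd_imp_eq two_is_prime_nat)
qed

text \<open>Turns the subfields of the theorem into Frobenius equations. Multiplication by a nonzero
  \<open>u\<close> of \<open>K\<close> permutes the nonzero elements, which gives the equation on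
  \<open>K\<close>; a polynomial of degree at most \<open>card K\<close> has no room for further
  roots.\<close>

lemma subfield_iff_power_card:
  fixes K :: "'a::field set"
  assumes K: "subfield K (ring_of_type_algebra :: 'a ring)" and "finite K"
  shows "x \<in> K \<longleftrightarrow> x ^ card K = x"
proof -
  note sub = subringE[OF subfieldE(1)[OF K], unfolded ring_of_type_algebra_def, simplified]
  have K0: "0 \<in> K" and K1: "1 \<in> K" and K_mult: "\<And>u v. u \<in> K \<Longrightarrow> v \<in> K \<Longrightarrow> u * v \<in> K"
    using sub by auto
  have fixed: "u ^ card K = u" if "u \<in> K" for u
  proof (cases "u = 0")
    case False
    let ?K = "K - {0}"
    have "(\<lambda>v. u * v) ` ?K = ?K"
      by (rule endo_inj_surj) (use False \<open>finite K\<close> that K_mult in \<open>auto simp: inj_on_def\<close>)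
    moreover have "inj_on (\<lambda>v. u * v) ?K" using False by (auto simp: inj_on_def)
    ultimately have "\<Prod>?K = (\<Prod>v\<in>?K. u * v)"
      using prod.reindex[of "\<lambda>v. u * v" ?K id] by simp
    also have "\<dots> = u ^ card ?K * \<Prod>?K" by (simp add: prod.distrib)
    finally have "u ^ card ?K = 1" using \<open>finite K\<close> by simp
    moreover have "card K = Suc (card ?K)"
      using K0 \<open>finite K\<close> by (metis card.remove)
    ultimately show ?thesis by simp
  next
    case True
    then show ?thesis using K0 \<open>finite K\<close> by (auto simp: card_gt_0_iff zero_power)
  qed
  have "card {0, 1 :: 'a} \<le> card K" by (rule card_mono) (use K0 K1 \<open>finite K\<close> in auto)
  then have "card K \<ge> 2" by simp
  define p :: "'a poly" where "p = monom 1 (card K) - monom 1 1"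
  have "coeff p (card K) = 1" using \<open>card K \<ge> 2\<close> by (simp add: p_def)
  then have "p \<noteq> 0" by auto
  have roots: "{u. poly p u = 0} = {u. u ^ card K = u}" by (simp add: p_def poly_monom)
  have "degree p \<le> card K" unfolding p_def
    by (rule degree_diff_le) (use \<open>card K \<ge> 2\<close> in \<open>simp_all add: degree_monom_eq\<close>)
  then have "card {u :: 'a. u ^ card K = u} \<le> card K"
    using card_poly_roots_bound[OF \<open>p \<noteq> 0\<close>] unfolding roots by linarith
  moreover have "finite {u :: 'a. u ^ card K = u}" using poly_roots_finite[OF \<open>p \<noteq> 0\<close>] roots by simp
  moreover have "K \<subseteq> {u. u ^ card K = u}" using fixed by auto
  ultimately have "K = {u. u ^ card K = u}" by (metis card_seteq)
  then show ?thesis by auto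
qed

lemma power_CARD_eq_self:
  fixes x :: "'a::{finite,field}"
  shows "x ^ CARD('a) = x"
proof -
  interpret field "ring_of_type_algebra :: 'a ring" by (rule field_from_type_algebra)
  have "subfield UNIV (ring_of_type_algebra :: 'a ring)"
    using carrier_is_subfield by (simp add: ring_of_type_algebra_def)
  then show ?thesis using subfield_iff_power_card[of UNIV x] by simp
qed

text \<open>For even \<open>n\<close>, 3 divides \<open>2 ^ n - 1\<close>. With \<open>r\<close> a
  third of it, \<open>x ^ r = 1\<close> cannot hold for all nonzero \<open>x\<close>, and any
  exception yields \<open>w = x ^ r\<close>.\<close>

lemma obtain_primitive_cube_root:
  assumes "CARD('a::{finite,field}) = 2 ^ n" and "even n" "n > 0"
  obtains w :: "'a::{finite,field}" where "w ^ 2 + w + 1 = 0"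
proof -
  obtain j where j: "n = 2 * j" using \<open>even n\<close> by blast
  have "(2::nat) ^ n mod 3 = (4 mod 3) ^ j mod 3"
    unfolding j by (simp only: power_mod) (simp add: power_mult)
  then have "(2::nat) ^ n mod 3 = 1" by simp
  moreover define r where "r = (2::nat) ^ n div 3"
  ultimately have r: "2 ^ n = Suc (3 * r)" by presburger
  have "(2::nat) ^ 1 \<le> 2 ^ n" by (rule power_increasing) (use \<open>n > 0\<close> in auto)
  then have "r > 0" using r by (cases r) auto
  have "\<exists>x::'a. x \<noteq> 0 \<and> x ^ r \<noteq> 1"
  proof (rule ccontr)
    assume contra: "\<not> ?thesis"
    define p :: "'a poly" where "p = monom 1 r - 1"
    have "coeff p r = 1" using \<open>r > 0\<close> by (simp add: p_def)
    then have "p \<noteq> 0" by auto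
    have "UNIV - {0} \<subseteq> {x. poly p x = 0}" using contra by (auto simp: p_def poly_monom)
    then have "card (UNIV - {0::'a}) \<le> card {x. poly p x = 0}" by (intro card_mono) auto
    also have "\<dots> \<le> degree p" by (rule card_poly_roots_bound[OF \<open>p \<noteq> 0\<close>])
    also have "\<dots> \<le> r" unfolding p_def by (rule degree_diff_le) (simp_all add: degree_monom_eq)
    finally show False using assms(1) r \<open>r > 0\<close> by (simp add: card_Diff_singleton)
  qed
  then obtain x :: 'a where "x \<noteq> 0" "x ^ r \<noteq> 1" by blast
  have "x * x ^ (r * 3) = x" using power_CARD_eq_self[of x] assms(1) r by (simp add: mult.commute)
  then have "(x ^ r) ^ 3 = 1" using \<open>x \<noteq> 0\<close> by (simp flip: power_mult)
  then have "(x ^ r - 1) * ((x ^ r) ^ 2 + x ^ r + 1) = 0"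
    by (simp add: algebra_simps eval_nat_numeral)
  then show thesis using that \<open>x ^ r \<noteq> 1\<close> by simp
qed

section \<open>Solution sets of the difference equation for inversion\<close>

lemma inverse_diff_solutions:
  fixes a :: "'a::field"
  assumes char2: "CHAR('a) = 2" and "a \<noteq> 0" and "c \<noteq> inverse a"
  shows "\<exists>p q. {x. inverse x + inverse (x + a) = c} \<subseteq> {p, q}"
proof (cases "{x. inverse x + inverse (x + a) = c} = {}")
  case False
  note c2 = two_eq_0[OF char2] char2_simps[OF char2]
  \<comment> \<open>Since \<open>c\<close> differs from \<open>inverse a\<close>, neither 0 nor
    \<open>a\<close> is a solution. All solutions then share the value of
    \<open>u * (u + a)\<close>, so any two differ by 0 or \<open>a\<close>.\<close>
  have quad: "c * (u * (u + a)) = a" if "inverse u + inverse (u + a) = c" for u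
  proof -
    have "u \<noteq> 0" "u + a \<noteq> 0" using that \<open>c \<noteq> inverse a\<close> c2 by auto
    then have "c * (u * (u + a)) = u + a + u"
      unfolding that[symmetric] by (simp add: divide_simps distrib_right)
    then show ?thesis using c2 by (simp add: add_ac)
  qed
  obtain x where x: "inverse x + inverse (x + a) = c" using False by blast
  have "z \<in> {x, x + a}" if z: "inverse z + inverse (z + a) = c" for z
  proof -
    have "c \<noteq> 0" using quad[OF x] \<open>a \<noteq> 0\<close> by auto
    then have "z * (z + a) = x * (x + a)" using quad[OF x] quad[OF z] by (metis mult_left_cancel)
    then have "(z - x) * (z - (x + a)) = 0" by (simp add: c2 algebra_simps)
    then show ?thesis by auto
  qed
  then show ?thesis by blast
qed simp

text \<open>Away from 0 and \<open>a\<close> the equation becomes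
  \<open>x ^ 2 + a * x + a ^ 2 = 0\<close>, which splits by means of \<open>w\<close>.\<close>

lemma inverse_diff_solutions_special:
  fixes a :: "'a::field"
  assumes char2: "CHAR('a) = 2" and "a \<noteq> 0" and w: "w ^ 2 + w + 1 = 0"
  shows "{x. inverse x + inverse (x + a) = inverse a} \<subseteq> {0, a, a * w, a * w ^ 2}"
proof (rule subsetI, rule ccontr)
  note c2 = two_eq_0[OF char2] char2_simps[OF char2]
  fix x
  assume "x \<in> {x. inverse x + inverse (x + a) = inverse a}" "x \<notin> {0, a, a * w, a * w ^ 2}"
  then have x: "inverse x + inverse (x + a) = inverse a" "x \<noteq> 0" "x \<noteq> a" "x \<noteq> a * w" "x \<noteq> a * w ^ 2"
    by auto
  then have "x + a \<noteq> 0" using c2 by simp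
  then have "(x + a + x) * a = x * (x + a)"
    using x \<open>a \<noteq> 0\<close> by (simp add: field_simps)
  moreover have w2: "w ^ 2 = w + 1" using w c2 by (metis add.assoc)
  moreover have "x + a + x = a" using c2 by (simp add: add_ac)
  ultimately have "(x - a * w) * (x - a * w ^ 2) = 0"
    using w2 by (simp add: c2 algebra_simps power2_eq_square)
  then show False using x by simp
qed

lemma card_le_4_if_subset: "A \<subseteq> {p, q, r, s} \<Longrightarrow> card A \<le> 4"
  using card_mono[of "{p, q, r, s}" A] card_length[of "[p, q, r, s]"] by simp

section \<open>Bijectivity and the exact differential uniformity\<close>

theorem theorem4:
  fixes n k1 :: nat
    and F8 Fk1 S :: "'a::{finite,field} set"
    and f :: "'a::{finite,field} \<Rightarrow> 'a"
  assumes "n > 0" and "6 dvd n" and "odd (n div 6)"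
    and "CARD('a) = 2 ^ n"
    and "k1 dvd n" and "even k1" and "gcd 3 k1 = 1"
    and "subfield F8 (ring_of_type_algebra :: 'a ring)" and "card F8 = 2 ^ 3"
    and "subfield Fk1 (ring_of_type_algebra :: 'a ring)" and "card Fk1 = 2 ^ k1"
    and "S = F8 \<union> Fk1"
    and "f = (\<lambda>x. inverse x + indicator S x)"
  shows "bij f \<and> differentially_4_uniform f"
proof -
  have char2: "CHAR('a) = 2" using CHAR_eq_2 assms(4) .
  note c2 = two_eq_0[OF char2] char2_simps[OF char2]
  have not3: "\<not> 3 dvd k1" using assms(7) by (metis gcd_nat.absorb1 numeral_eq_one_iff num.distinct(3))
  have "even n" using \<open>6 dvd n\<close> by presburger
  then obtain w :: 'a where w: "w ^ 2 + w + 1 = 0"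
    using obtain_primitive_cube_root assms(1,4) by blast
  have w2: "w ^ 2 = w + 1" using w c2 by (metis add.assoc)
  have w4: "w ^ 4 = w"
  proof -
    have "w ^ 4 = (w ^ 2) ^ 2" by (simp flip: power_mult)
    then show ?thesis unfolding w2 frobenius_add_numeral[OF char2] by (simp add: w2 c2 add_ac)
  qed
  have S: "S = {x. x ^ 8 = x} \<union> {x. x ^ (2 ^ k1) = x}"
    using subfield_iff_power_card[OF assms(8)] subfield_iff_power_card[OF assms(10)] assms(9,11,12)
    by auto
  have S_inverse: "inverse x \<in> S \<longleftrightarrow> x \<in> S" for x unfolding S by (simp add: power_inverse)
  have S_add1: "x + 1 \<in> S \<longleftrightarrow> x \<in> S" for x
    unfolding S by (simp add: frobenius_add[OF char2] frobenius_add_numeral[OF char2])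
  have "0 \<in> S" and "1 \<in> S" unfolding S by auto
  \<comment> \<open>The field of order 4 lies in \<open>Fk1\<close> because \<open>k1\<close> is
    even.\<close>
  have "w \<in> S"
    using frobenius_fixed_mult[of w 2 "k1 div 2"] w4 \<open>even k1\<close> unfolding S by simp
  have bij: "bij f"
  proof -
    define g where "g y = y + indicator S y" for y :: 'a
    have "g (g y) = y" for y
      using S_add1[of y] c2 by (cases "y \<in> S") (auto simp: g_def add.assoc)
    then have "bij g" by (intro o_bij[of g g]) auto
    moreover have "bij (inverse :: 'a \<Rightarrow> 'a)" by (intro o_bij[of inverse inverse]) auto
    moreover have "f = g \<circ> inverse"
      using S_inverse by (auto simp: assms(13) g_def indicator_def)
    ultimately show ?thesis using bij_comp by blast
  qed
  have upper: "differential_count f a b \<le> 4" if "a \<noteq> 0" for a b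
  proof -
    define P where "P c = {x. inverse x + inverse (x + a) = c}" for c
    \<comment> \<open>\<open>E x\<close> says that the two indicator values cancel in
      \<open>f (x + a) + f x\<close>; it decides whether \<open>b\<close> or \<open>b + 1\<close> is
      the target for inversion.\<close>
    define E where "E x \<longleftrightarrow> (x \<in> S \<longleftrightarrow> x + a \<in> S)" for x
    define D where "D = {x. f (x + a) + f x = b}"
    have "f (x + a) + f x = b \<longleftrightarrow>
        inverse x + inverse (x + a) = b + (if E x then 0 else 1)" for x
      unfolding assms(13) E_def using c2
      by (auto simp: indicator_def algebra_simps)
    then have D: "D = {x \<in> P b. E x} \<union> {x \<in> P (b + 1). \<not> E x}"
      unfolding D_def P_def by auto
    have pair: "\<exists>p q. P c \<subseteq> {p, q}" if "c \<noteq> inverse a" for c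
      unfolding P_def using inverse_diff_solutions[OF char2 \<open>a \<noteq> 0\<close> that] .
    have special: "P (inverse a) \<subseteq> {0, a, a * w, a * w ^ 2}"
      unfolding P_def using inverse_diff_solutions_special[OF char2 \<open>a \<noteq> 0\<close> w] .
    have "\<exists>p q r s. D \<subseteq> {p, q, r, s}"
    proof -
      consider "b = inverse a" | "b = inverse a + 1" | "b \<noteq> inverse a" "b + 1 \<noteq> inverse a"
        using c2 by (metis add.commute)
      then show ?thesis
      proof cases
        case 1
        then have special_b: "P b \<subseteq> {0, a, a * w, a * w ^ 2}" using special by simp
        have "b + 1 \<noteq> inverse a" using 1 by simp
        then obtain p q where pq: "P (b + 1) \<subseteq> {p, q}" using pair by blast
        show ?thesis
        proof (cases "\<exists>x \<in> P (b + 1). \<not> E x")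
          case True
          \<comment> \<open>The swap of \<open>x\<close> and \<open>x + a\<close> preserves
            \<open>P (b + 1)\<close>, so the member in \<open>S\<close> can be called
            \<open>x\<close>.\<close>
          then obtain x where x: "x \<in> S" "x + a \<notin> S" "x \<in> P (b + 1)"
          proof -
            obtain z where z: "z \<in> P (b + 1)" "\<not> E z" using True by blast
            have "z + a + a = z" using c2 by (simp add: add.assoc)
            moreover from this have "z + a \<in> P (b + 1)"
              using z(1) unfolding P_def by (simp only: mem_Collect_eq add.commute[of "inverse z"])
            ultimately show thesis
              using that[of z] that[of "z + a"] z unfolding E_def by auto
          qed
          have "a \<notin> S"
            using quadratic_case_excluded[OF char2 \<open>even k1\<close> not3 \<open>a \<noteq> 0\<close> S _ x(1,2)] x(3) 1 unfolding P_def by auto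
          \<comment> \<open>Hence 0 and \<open>a\<close> drop out of \<open>P b\<close>, making room
            for \<open>p\<close> and \<open>q\<close>.\<close>
          then have "\<not> E 0" "\<not> E a" unfolding E_def using \<open>0 \<in> S\<close> c2 by auto
          moreover have "D \<subseteq> {p, q} \<union> {x \<in> {0, a, a * w, a * w ^ 2}. E x}"
            unfolding D using pq special_b by blast
          ultimately have "D \<subseteq> {p, q, a * w, a * w ^ 2}" by blast
          then show ?thesis by blast
        next
          case False
          then have "D \<subseteq> {0, a, a * w, a * w ^ 2}" unfolding D using special_b by blast
          then show ?thesis by blast
        qed
      next
        case 2
        then have b1: "b + 1 = inverse a" using c2 by (simp add: add.assoc)
        have "b \<noteq> inverse a" using 2 by simp
        then obtain p q where pq: "P b \<subseteq> {p, q}" using pair by blast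
        show ?thesis
        proof (cases "P b = {}")
          case True
          then have "D \<subseteq> {0, a, a * w, a * w ^ 2}" unfolding D b1 using special by blast
          then show ?thesis by blast
        next
          case False
          then obtain x where x: "inverse x + inverse (x + a) = inverse a + 1"
            using 2 unfolding P_def by blast
          have fixed: "y ^ (64 ^ (n div 6)) = y" for y :: 'a
          proof -
            have "(64::nat) ^ (n div 6) = (2 ^ 6) ^ (n div 6)" by simp
            also have "\<dots> = 2 ^ n" using \<open>6 dvd n\<close> by (simp only: power_mult[symmetric]) simp
            finally show ?thesis using power_CARD_eq_self[of y] assms(4) by simp
          qed
          \<comment> \<open>The other primitive cube root, so that the exclusion applies to
            \<open>a * w ^ 2\<close> as well.\<close>
          have "(w ^ 2) ^ 2 + w ^ 2 + 1 = 0"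
            using w4 w by (simp add: add_ac flip: power_mult)
          note excluded = trace_case_excluded[OF char2 \<open>even k1\<close> not3 _ S _ _ fixed assms(3) x]
          have aw: "a * w \<notin> S" "a * w ^ 2 \<notin> S" if "a \<notin> S"
            using excluded w \<open>(w ^ 2) ^ 2 + w ^ 2 + 1 = 0\<close> that by blast+
          have "a * w + a = a * w ^ 2" "a * w ^ 2 + a = a * w"
            unfolding w2 using c2 by (simp_all add: algebra_simps)
          \<comment> \<open>If \<open>a\<close> is in \<open>S\<close>, then \<open>E\<close> holds
            at 0 and \<open>a\<close>. Otherwise \<open>a * w\<close> and \<open>a * w ^ 2\<close>
            are both outside \<open>S\<close> and differ by \<open>a\<close>. Either way two special
            solutions drop out.\<close>
          then have E: "(E 0 \<and> E a) \<or> (E (a * w) \<and> E (a * w ^ 2))"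
            unfolding E_def using aw \<open>0 \<in> S\<close> c2 by auto
          have sub: "D \<subseteq> {p, q} \<union> {x \<in> {0, a, a * w, a * w ^ 2}. \<not> E x}"
            unfolding D b1 using pq special by blast
          from E show ?thesis
          proof
            assume "E 0 \<and> E a"
            then have "D \<subseteq> {p, q, a * w, a * w ^ 2}" using sub by blast
            then show ?thesis by blast
          next
            assume "E (a * w) \<and> E (a * w ^ 2)"
            then have "D \<subseteq> {p, q, 0, a}" using sub by blast
            then show ?thesis by blast
          qed
        qed
      next
        case 3
        then obtain p q r s where "P b \<subseteq> {p, q}" "P (b + 1) \<subseteq> {r, s}" using pair by meson
        then have "D \<subseteq> {p, q, r, s}" unfolding D by blast
        then show ?thesis by blast
      qed
    qed
    then have "card D \<le> 4" by (elim exE) (rule card_le_4_if_subset)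
    then show ?thesis unfolding differential_count_def D_def .
  qed
  have attained: "differential_count f 1 1 = 4"
  proof -
    have "w \<noteq> 0" "w \<noteq> 1" using w2 c2(1) by auto
    have "w + 1 \<in> S" using \<open>w \<in> S\<close> S_add1 by blast
    have "w * (w + 1) = 1" using w2 c2 by (simp add: algebra_simps power2_eq_square)
    then have inv: "inverse w = w + 1" "inverse (w + 1) = w"
      by (metis inverse_unique, metis inverse_unique mult.commute)
    \<comment> \<open>The field of order 4 lies in \<open>S\<close>, so the indicators cancel and
      its four elements solve the equation for inversion.\<close>
    have "{0, 1, w, w + 1} \<subseteq> {x. f (x + 1) + f x = 1}"
      using \<open>0 \<in> S\<close> \<open>1 \<in> S\<close> \<open>w \<in> S\<close> \<open>w + 1 \<in> S\<close> inv c2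
      by (simp add: assms(13) algebra_simps)
    then have "card {0, 1, w, w + 1} \<le> differential_count f 1 1"
      unfolding differential_count_def by (intro card_mono) auto
    moreover have "card {0, 1, w, w + 1} = 4"
      using \<open>w \<noteq> 0\<close> \<open>w \<noteq> 1\<close> c2 by (auto simp: card_insert_if)
    ultimately show ?thesis using upper[of 1 1] by simp
  qed
  have "differential_uniformity f = 4"
    unfolding differential_uniformity_def
  proof (rule Max_eqI)
    show "finite {differential_count f a b | a b. a \<noteq> 0}"
      by (rule finite_subset[of _ "range (\<lambda>(a, b). differential_count f a b)"]) auto
    show "4 \<in> {differential_count f a b | a b. a \<noteq> 0}"
      using attained by (metis (mono_tags, lifting) mem_Collect_eq zero_neq_one)
  qed (use upper in auto)
  then show ?thesis using bij unfolding differentially_4_uniform_def by simp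
qed

end
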